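(* Let $m,n\ge 2$, let $\mathcal{A}^I=[\underline{\mathcal{A}},\overline{\mathcal{A}}]$ be an interval tensor in $T_{m,n}$, and suppose $R_i(\underline{\mathcal{A}})>0$ for all $i\in[n]$. If $$\overline{S}:=\sum_{i=1}^n\Bigl[\max_{\{J\in[n]^{m-1}:\,i\in J\}}\overline{M}_J\Bigr]_+^{\frac{1}{m-1}}<1,$$ then there exists a positive vector $\pi\in\mathbb{R}^n$ satisfying $0<\sum_{J\in[n]^{m-1}}\pi_J\le 1$ such that $\mathcal{A}^I$ is an interval $B_{\pi}^{R^I}$-tensor.
   Context: $[n]=\{1,\dots,n\}$. $T_{m,n}$ is the set of real $m$th-order $n$-dimensional tensors $\mathcal{A}=(a_{i_1\cdots i_m})$, $i_1,\dots,i_m\in[n]$. For $J=(i_2,\dots,i_m)\in[n]^{m-1}$ write $a_{iJ}=a_{ii_2\cdots i_m}$; $i\in J$ means that $i$ is one of the components of $J$. The $i$th row sum is $R_i(\mathcal{A})=\sum_{J\in[n]^{m-1}}a_{iJ}$. For a nonnegative vector $\pi=(\pi_1,\dots,\pi_n)$, $\pi_J:=\pi_{i_2}\cdots\pi_{i_m}$. $[a]_+=\max\{0,a\}$. A tensor $\mathcal{A}\in T_{m,n}$ is a $B_\pi^R$-tensor (where $\pi$ is a nonnegative vector with $0<\sum_{J\in[n]^{m-1}}\pi_J\le1$ and the superscript $R$ denotes the row sum vector of $\mathcal{A}$ itself) if for all $i\in[n]$: $R_i(\mathcal{A})>0$, and $\pi_JR_i(\mathcal{A})>a_{iJ}$ for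 all $J\in[n]^{m-1}\setminus\{(i,\dots,i)\}$. For $\underline{\mathcal{A}}\le\overline{\mathcal{A}}$ (componentwise) in $T_{m,n}$, the interval tensor is $\mathcal{A}^I=[\underline{\mathcal{A}},\overline{\mathcal{A}}]=\{\mathcal{A}:\underline{\mathcal{A}}\le\mathcal{A}\le\overline{\mathcal{A}}\}$. It is an interval $B_\pi^{R^I}$-tensor if every $\mathcal{A}\in\mathcal{A}^I$ is a $B_\pi^R$-tensor (same $\pi$, with $R=R(\mathcal{A})$). For $J\in[n]^{m-1}$ define $$\overline{M}_{iJ}=\max\Bigl\{\frac{\overline{a}_{iJ}}{\overline{a}_{iJ}+\sum_{K\in[n]^{m-1},\,K\ne J}\underline{a}_{iK}},\ \frac{\overline{a}_{iJ}}{R_i(\overline{\mathcal{A}})}\Bigr\},\qquad \overline{M}_J=\max_{i\in[n],\ (i,\dots,i)\ne J}\overline{M}_{iJ}.$$ *)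

theory Defs
  imports Complex_Main "HOL-Library.FuncSet"
begin

text \<open>Multi-indices in \<open>[n]\<^sup>k\<close> are lists of length \<open>k\<close> with entries in \<open>{1..n}\<close>; the entry
  \<open>a\<^sub>i\<^sub>J\<close> of a tensor \<open>A\<close> is \<open>A (i # J)\<close>. Order and dimension are explicit natural numbers, and
  tensors are extensional functions, so that equal entries mean equal tensors.\<close>

definition multi_idx :: "nat \<Rightarrow> nat \<Rightarrow> nat list set" where
  "multi_idx n k = {J. length J = k \<and> set J \<subseteq> {1..n}}"

type_synonym tensor = "nat list \<Rightarrow> real"

definition tensors :: "nat \<Rightarrow> nat \<Rightarrow> tensor set" where
  "tensors m n = (multi_idx n m \<rightarrow>\<^sub>E UNIV)"

definition tensor_le :: "nat \<Rightarrow> nat \<Rightarrow> tensor \<Rightarrow> tensor \<Rightarrow> bool" where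
  "tensor_le m n A B \<longleftrightarrow> (\<forall>I\<in>multi_idx n m. A I \<le> B I)"

definition interval_tensor :: "nat \<Rightarrow> nat \<Rightarrow> tensor \<Rightarrow> tensor \<Rightarrow> tensor set" where
  "interval_tensor m n L U = {A \<in> tensors m n. tensor_le m n L A \<and> tensor_le m n A U}"

definition row_sum :: "nat \<Rightarrow> nat \<Rightarrow> tensor \<Rightarrow> nat \<Rightarrow> real" where
  "row_sum m n A i = (\<Sum>J\<in>multi_idx n (m - 1). A (i # J))"

definition vec_prod :: "(nat \<Rightarrow> real) \<Rightarrow> nat list \<Rightarrow> real" where
  "vec_prod \<pi> J = prod_list (map \<pi> J)"

definition B_pi_R_tensor :: "nat \<Rightarrow> nat \<Rightarrow> (nat \<Rightarrow> real) \<Rightarrow> tensor \<Rightarrow> bool" where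
  "B_pi_R_tensor m n \<pi> A \<longleftrightarrow>
     A \<in> tensors m n \<and>
     (\<forall>i\<in>{1..n}. 0 \<le> \<pi> i) \<and>
     0 < (\<Sum>J\<in>multi_idx n (m - 1). vec_prod \<pi> J) \<and>
     (\<Sum>J\<in>multi_idx n (m - 1). vec_prod \<pi> J) \<le> 1 \<and>
     (\<forall>i\<in>{1..n}. row_sum m n A i > 0 \<and>
        (\<forall>J\<in>multi_idx n (m - 1) - {replicate (m - 1) i}.
           vec_prod \<pi> J * row_sum m n A i > A (i # J)))"

definition interval_B_pi_R_tensor ::
    "nat \<Rightarrow> nat \<Rightarrow> (nat \<Rightarrow> real) \<Rightarrow> tensor set \<Rightarrow> bool" where
  "interval_B_pi_R_tensor m n \<pi> AI \<longleftrightarrow> (\<forall>A\<in>AI. B_pi_R_tensor m n \<pi> A)"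

definition M_bar_row :: "nat \<Rightarrow> nat \<Rightarrow> tensor \<Rightarrow> tensor \<Rightarrow> nat \<Rightarrow> nat list \<Rightarrow> real" where
  "M_bar_row m n L U i J =
     max (U (i # J) / (U (i # J) + (\<Sum>K\<in>multi_idx n (m - 1) - {J}. L (i # K))))
         (U (i # J) / row_sum m n U i)"

text \<open>The maxima below range over nonempty sets whenever \<open>m, n \<ge> 2\<close>.\<close>

definition M_bar :: "nat \<Rightarrow> nat \<Rightarrow> tensor \<Rightarrow> tensor \<Rightarrow> nat list \<Rightarrow> real" where
  "M_bar m n L U J =
     Max ((\<lambda>i. M_bar_row m n L U i J) ` {i\<in>{1..n}. replicate (m - 1) i \<noteq> J})"

definition S_bar :: "nat \<Rightarrow> nat \<Rightarrow> tensor \<Rightarrow> tensor \<Rightarrow> real" where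
  "S_bar m n L U =
     (\<Sum>i=1..n. (max 0 (Max (M_bar m n L U ` {J\<in>multi_idx n (m - 1). i \<in> set J})))
                  powr (1 / (real m - 1)))"

end

theory Submission
  imports Defs
begin

text \<open>Write \<open>x\<^sub>i\<close> for the \<open>i\<close>-th summand of \<open>S_bar\<close>, so that \<open>\<Sum>x\<^sub>i < 1\<close>, and spread the slack evenly:
  \<open>\<pi>\<^sub>i = x\<^sub>i + (1 - S_bar) / n\<close>. Then \<open>\<pi>\<close> is positive with \<open>\<Sum>\<pi>\<^sub>i = 1\<close>, and expanding the power
  (\<open>sum_vec_prod\<close>) gives \<open>\<Sum>\<^sub>J \<pi>\<^sub>J = (\<Sum>\<pi>\<^sub>i)\<^sup>m\<^sup>-\<^sup>1 = 1\<close>; in particular every \<open>\<pi>\<^sub>J\<close> is at most \<open>1\<close>.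
  Each component \<open>j\<close> of \<open>J\<close> satisfies \<open>\<pi>\<^sub>j > x\<^sub>j\<close>, and \<open>x\<^sub>j\<close> is at least the \<open>(m-1)\<close>-th root of the
  positive part of \<open>M_bar J\<close>; multiplying over the \<open>m - 1\<close> components gives \<open>\<pi>\<^sub>J > M_bar J\<close>.

  Fix \<open>i\<close> and \<open>J \<noteq> (i, \<dots>, i)\<close>, and let \<open>s\<close> be the sum of the lower bounds of row \<open>i\<close> off \<open>J\<close>. With
  \<open>u = U (i # J)\<close>, the sum \<open>u + s\<close> is at least the row sum of \<open>L\<close>, hence positive; since \<open>M_bar J\<close>
  dominates \<open>u / (u + s)\<close>, it follows that \<open>u < \<pi>\<^sub>J (u + s)\<close>. Replacing \<open>u\<close> by
  an entry \<open>a \<le> u\<close> lowers the left side by \<open>u - a\<close> and the right side only by \<open>\<pi>\<^sub>J (u - a) \<le> u - a\<close>, so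
  \<open>a < \<pi>\<^sub>J (a + s)\<close>; and \<open>a + s\<close> is at most the row sum of any tensor in the interval with entry \<open>a\<close>
  at \<open>(i, J)\<close>. No case distinction on signs is needed.\<close>

lemma multi_idx_Suc:
  "multi_idx n (Suc k) = (\<lambda>(i, J). i # J) ` ({1..n} \<times> multi_idx n k)"
  by (auto simp: multi_idx_def length_Suc_conv image_iff)

lemma finite_multi_idx: "finite (multi_idx n k)"
  using finite_lists_length_eq[of "{1..n}" k] by (simp add: multi_idx_def conj_commute)

lemma sum_vec_prod:
  "(\<Sum>J\<in>multi_idx n k. vec_prod \<pi> J) = (\<Sum>i=1..n. \<pi> i) ^ k"
proof (induction k)
  case 0
  have "multi_idx n 0 = {[]}" by (auto simp: multi_idx_def)
  then show ?case by (simp add: vec_prod_def)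
next
  case (Suc k)
  have "inj_on (\<lambda>(i, J). i # J) ({1..n} \<times> multi_idx n k)"
    by (auto simp: inj_on_def)
  then have "(\<Sum>J\<in>multi_idx n (Suc k). vec_prod \<pi> J)
      = (\<Sum>(i, J)\<in>{1..n} \<times> multi_idx n k. \<pi> i * vec_prod \<pi> J)"
    by (simp add: multi_idx_Suc sum.reindex case_prod_unfold vec_prod_def)
  also have "\<dots> = (\<Sum>i=1..n. \<pi> i) * (\<Sum>J\<in>multi_idx n k. vec_prod \<pi> J)"
    by (simp add: sum_product sum.cartesian_product)
  finally show ?case by (simp add: Suc.IH)
qed

lemma vec_prod_pos:
  assumes "\<And>j. j \<in> set J \<Longrightarrow> 0 < \<pi> j"
  shows "0 < vec_prod \<pi> J"
  using assms by (induction J) (auto simp: vec_prod_def)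

lemma power_length_less_vec_prod:
  assumes "J \<noteq> []" and "0 \<le> c" and "\<And>j. j \<in> set J \<Longrightarrow> c < \<pi> j"
  shows "c ^ length J < vec_prod \<pi> J"
  using assms
proof (induction J rule: list_nonempty_induct)
  case (single j)
  then show ?case by (simp add: vec_prod_def)
next
  case (cons j J)
  then have "c * c ^ length J < \<pi> j * vec_prod \<pi> J"
    by (intro mult_strict_mono') auto
  then show ?case by (simp add: vec_prod_def)
qed

lemma row_sum_remove:
  assumes "J \<in> multi_idx n (m - 1)"
  shows "row_sum m n A i = A (i # J) + (\<Sum>K\<in>multi_idx n (m - 1) - {J}. A (i # K))"
  unfolding row_sum_def using assms by (simp add: sum.remove finite_multi_idx)

lemma Cons_in_multi_idx:
  assumes "1 \<le> m" and "i \<in> {1..n}" and "J \<in> multi_idx n (m - 1)"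
  shows "i # J \<in> multi_idx n m"
  using assms by (auto simp: multi_idx_def)

lemma M_bar_row_le_M_bar:
  assumes "i \<in> {1..n}" and "J \<noteq> replicate (m - 1) i"
  shows "M_bar_row m n L U i J \<le> M_bar m n L U J"
  unfolding M_bar_def using assms by (intro Max_ge) auto

lemma row_sum_mono:
  assumes "1 \<le> m" and "i \<in> {1..n}" and "tensor_le m n A B"
  shows "row_sum m n A i \<le> row_sum m n B i"
  unfolding row_sum_def using assms
  by (intro sum_mono) (auto simp: tensor_le_def Cons_in_multi_idx)

text \<open>The only property of \<open>M_bar_row\<close> needed is that it dominates the quotient for the upper entry
  against the lower bounds elsewhere in the row.\<close>

lemma entry_less_vec_prod_row_sum:
  assumes m: "1 \<le> m" and i: "i \<in> {1..n}" and J: "J \<in> multi_idx n (m - 1)"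
    and LA: "tensor_le m n L A" and AU: "tensor_le m n A U"
    and L_pos: "0 < row_sum m n L i"
    and p: "M_bar_row m n L U i J < p" "0 \<le> p" "p \<le> 1"
  shows "A (i # J) < p * row_sum m n A i"
proof -
  define s where "s = (\<Sum>K\<in>multi_idx n (m - 1) - {J}. L (i # K))"
  define a where "a = A (i # J)"
  define u where "u = U (i # J)"
  have iJ: "i # J \<in> multi_idx n m" using Cons_in_multi_idx[OF m i J] .
  have la: "L (i # J) \<le> a" and au: "a \<le> u"
    using LA AU iJ by (auto simp: tensor_le_def a_def u_def)
  have us: "0 < u + s"
    using L_pos la au by (simp add: row_sum_remove[OF J] s_def)
  have "u / (u + s) < p"
    using p(1) by (simp add: M_bar_row_def u_def s_def)
  then have "u < p * (u + s)" using us by (simp add: divide_less_eq)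
  moreover have "p * (u - a) \<le> u - a"
    using p au mult_right_mono[of p 1 "u - a"] by simp
  ultimately have "a < p * (a + s)" by (simp add: algebra_simps)
  also have "\<dots> \<le> p * row_sum m n A i"
  proof -
    have "s \<le> (\<Sum>K\<in>multi_idx n (m - 1) - {J}. A (i # K))"
      unfolding s_def using LA m i
      by (intro sum_mono) (auto simp: tensor_le_def Cons_in_multi_idx)
    then show ?thesis
      using p(2) by (intro mult_left_mono) (simp_all add: row_sum_remove[OF J] a_def)
  qed
  finally show ?thesis by (simp add: a_def)
qed

text \<open>The \<open>i\<close>-th summand of \<open>S_bar\<close>.\<close>

definition S_bar_term :: "nat \<Rightarrow> nat \<Rightarrow> tensor \<Rightarrow> tensor \<Rightarrow> nat \<Rightarrow> real" where
  "S_bar_term m n L U i =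
     (max 0 (Max (M_bar m n L U ` {J\<in>multi_idx n (m - 1). i \<in> set J}))) powr (1 / (real m - 1))"

lemma M_bar_less_vec_prod:
  assumes m: "2 \<le> m" and J: "J \<in> multi_idx n (m - 1)"
    and x: "\<And>i. i \<in> {1..n} \<Longrightarrow> S_bar_term m n L U i < \<pi> i"
  shows "M_bar m n L U J < vec_prod \<pi> J"
proof -
  define y where "y = max 0 (M_bar m n L U J)"
  define c where "c = y powr (1 / (real m - 1))"
  have len: "length J = m - 1" and sub: "set J \<subseteq> {1..n}"
    using J by (auto simp: multi_idx_def)
  have "c < \<pi> j" if j: "j \<in> set J" for j
  proof -
    have "M_bar m n L U J \<le> Max (M_bar m n L U ` {J\<in>multi_idx n (m - 1). j \<in> set J})"
      using J j by (intro Max_ge) (auto simp: finite_multi_idx)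
    then have "c \<le> S_bar_term m n L U j"
      unfolding c_def y_def S_bar_term_def using m by (intro powr_mono2) auto
    also have "\<dots> < \<pi> j" using x sub j by blast
    finally show ?thesis .
  qed
  then have "c ^ length J < vec_prod \<pi> J"
    using len m by (intro power_length_less_vec_prod) (auto simp: c_def)
  moreover have "c ^ length J = y"
  proof -
    have "c ^ length J = c powr (real m - 1)" if "0 < y"
      using that m by (simp add: c_def len powr_realpow[symmetric] of_nat_diff)
    then show ?thesis
      using m by (cases "y = 0") (auto simp: c_def y_def len powr_powr)
  qed
  ultimately show ?thesis by (simp add: y_def)
qed

theorem theorem4p2:
  fixes m n :: nat and L U :: tensor
  assumes "m \<ge> 2" and "n \<ge> 2"
    and "L \<in> tensors m n" and "U \<in> tensors m n"
    and "tensor_le m n L U"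
    and "\<forall>i\<in>{1..n}. row_sum m n L i > 0"
    and "S_bar m n L U < 1"
  shows "\<exists>\<pi> :: nat \<Rightarrow> real.
           (\<forall>i\<in>{1..n}. \<pi> i > 0) \<and>
           0 < (\<Sum>J\<in>multi_idx n (m - 1). vec_prod \<pi> J) \<and>
           (\<Sum>J\<in>multi_idx n (m - 1). vec_prod \<pi> J) \<le> 1 \<and>
           interval_B_pi_R_tensor m n \<pi> (interval_tensor m n L U)"
proof -
  define \<pi> where "\<pi> i = S_bar_term m n L U i + (1 - S_bar m n L U) / real n" for i
  have less: "S_bar_term m n L U i < \<pi> i" for i
    using assms by (simp add: \<pi>_def)
  have pos: "0 < \<pi> i" for i
    using less[of i] by (rule le_less_trans[rotated]) (simp add: S_bar_term_def)
  have "(\<Sum>i=1..n. \<pi> i) = S_bar m n L U + (1 - S_bar m n L U)"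
    using assms(2) by (simp add: \<pi>_def sum.distrib S_bar_def S_bar_term_def)
  then have sum1: "(\<Sum>J\<in>multi_idx n (m - 1). vec_prod \<pi> J) = 1"
    by (simp add: sum_vec_prod)
  have ppos: "0 < vec_prod \<pi> J" for J
    by (rule vec_prod_pos) (rule pos)
  have ple: "vec_prod \<pi> J \<le> 1" if "J \<in> multi_idx n (m - 1)" for J
    unfolding sum1[symmetric] using that ppos
    by (intro member_le_sum) (auto simp: finite_multi_idx less_imp_le)
  have "B_pi_R_tensor m n \<pi> A" if "A \<in> interval_tensor m n L U" for A
  proof -
    have A: "A \<in> tensors m n" "tensor_le m n L A" "tensor_le m n A U"
      using that by (auto simp: interval_tensor_def)
    have R: "0 < row_sum m n A i" if "i \<in> {1..n}" for i
      using row_sum_mono[of m i n L A] A(2) assms(1,6) that by fastforce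
    have "A (i # J) < vec_prod \<pi> J * row_sum m n A i"
      if i: "i \<in> {1..n}" and J: "J \<in> multi_idx n (m - 1)" and ne: "J \<noteq> replicate (m - 1) i" for i J
    proof (rule entry_less_vec_prod_row_sum[OF _ i J A(2,3)])
      show "M_bar_row m n L U i J < vec_prod \<pi> J"
        using M_bar_row_le_M_bar[OF i ne] M_bar_less_vec_prod[OF assms(1) J less]
        by (rule le_less_trans)
    qed (use assms i J ple less_imp_le[OF ppos] in auto)
    then show ?thesis
      using A(1) R sum1 pos by (auto simp: B_pi_R_tensor_def less_imp_le)
  qed
  then show ?thesis
    using pos sum1 by (intro exI[of _ \<pi>]) (auto simp: interval_B_pi_R_tensor_def)
qed

end
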